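(* Let $(X,d)$ be a pseudo-complete ultrametric space with at least two points and without unpartnered points. Then the set $P(X)$ of partnered points of $X$ is the unique 2-metric basis of $(X,d)$.
   Context: A metric space $(X,d)$ is ultrametric if $d(x,y)\le\max\{d(x,z),d(z,y)\}$ for all $x,y,z\in X$. Points $x,y\in X$ are distinguished by $z\in X$ if $d(x,z)\neq d(y,z)$. For a positive integer $k$, a set $S\subseteq X$ is a $k$-metric generator for $X$ if any pair of different points of $X$ is distinguished by at least $k$ elements of $S$. A $k$-metric basis is a $k$-metric generator of minimum cardinality in $X$. Write $B_r(x)=\{p\in X: d(x,p)<r\}$, with $B_\infty(x)=X$. Two different points $x,y\in X$ are partners if $d(x,z)\ge d(x,y)$ and $d(y,z)\ge d(x,y)$ for all $z\in X\smallsetminus\{x,y\}$. A point $x$ is partnered if there is $y\in X$ such that $x,y$ are partners. A point $x$ is pseudopartnered if it is not partnered but there is $y\in X$, $y\ne x$, with $d(x,z)\ge d(x,y)$ for all $z\in X\smallsetminus\{x,y\}$. A point is unpartnered if it is neither partnered nor pseudopartnered. Given a pseudopartnered point $x$, an $x$-pseudopartnering sequence $(x_n)_{n\ge 1}$ with associated distances $(d_n)_{n\ge1}$ is any sequence obtained inductively as follows: $x_1=x$, $d_1=\infty$. Given $x_n,d_n$: if $|B_{d_n}(x_n)|=1$ or $d_n=0$, put $x_{n+1}=x_n$, $d_{n+1}=0$. If $|B_{d_n}(x_n)|>1$, let $I_n=\{d(x_n,z): z\in B_{d_n}(x_n)\smallsetminus\{x_n\}\}$; if $I_n$ has no minimum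 put $x_{n+1}=x_n$, $d_{n+1}=0$; if $I_n$ has a minimum, choose any $x_{n+1}\in\{z\in X: d(x_n,z)=\min I_n\}$ and put $d_{n+1}=d(x_n,x_{n+1})$. A point $z\in X$ is a pseudolimit of a pseudopartnering sequence $(x_n)$ if $d(z,x_n)=d(x_n,x_{n+1})$ for every $n$. $(X,d)$ is pseudo-complete if for every pseudopartnered point $x\in X$: (i) every $x$-pseudopartnering sequence has a pseudolimit, and (ii) at least one $x$-pseudopartnering sequence has a finite number of pseudolimits.
   Formalization: Uniqueness of the 2-metric basis is claimed only if P(X) is finite or P(X)=X; if P(X) is infinite and not X, adding a point gives another basis of equal cardinality. Instead, P(X) is shown always to be a 2-metric basis contained in every 2-metric generator. *)

theory Defs
  imports "HOL-Analysis.Abstract_Metric_Spaces" "HOL-Library.Equipollence" "HOL-Library.Extended_Real"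
begin

locale Ultrametric_space = Metric_space M d for M :: "'a set" and d :: "'a \<Rightarrow> 'a \<Rightarrow> real" +
  assumes ultra: "\<lbrakk>x \<in> M; y \<in> M; z \<in> M\<rbrakk> \<Longrightarrow> d x y \<le> max (d x z) (d z y)"

section \<open>Metric generators and bases\<close>

definition distinguishes :: "('a \<Rightarrow> 'a \<Rightarrow> real) \<Rightarrow> 'a \<Rightarrow> 'a \<Rightarrow> 'a \<Rightarrow> bool" where
  "distinguishes d z x y \<longleftrightarrow> d x z \<noteq> d y z"

text \<open>Since \<open>card\<close> of an infinite set is 0, ``at least \<open>k\<close> elements'' admits infinite sets explicitly.\<close>
definition metric_generator ::
    "nat \<Rightarrow> 'a set \<Rightarrow> ('a \<Rightarrow> 'a \<Rightarrow> real) \<Rightarrow> 'a set \<Rightarrow> bool" where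
  "metric_generator k X d S \<longleftrightarrow> S \<subseteq> X \<and>
     (\<forall>x\<in>X. \<forall>y\<in>X. x \<noteq> y \<longrightarrow>
        infinite {z \<in> S. distinguishes d z x y} \<or> k \<le> card {z \<in> S. distinguishes d z x y})"

text \<open>\<open>S \<lesssim> T\<close> compares cardinalities, also of infinite sets.\<close>
definition metric_basis ::
    "nat \<Rightarrow> 'a set \<Rightarrow> ('a \<Rightarrow> 'a \<Rightarrow> real) \<Rightarrow> 'a set \<Rightarrow> bool" where
  "metric_basis k X d S \<longleftrightarrow> metric_generator k X d S \<and>
     (\<forall>T. metric_generator k X d T \<longrightarrow> S \<lesssim> T)"

text \<open>An infinite basis other than the whole space is never the only set of minimum cardinality:
  adjoining a point yields another basis. Uniqueness of a basis in the sense of cardinality is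
  therefore only possible for a finite basis or for the whole space.\<close>
lemma metric_basis_insert:
  assumes S: "metric_basis k X d S" and inf: "infinite S" and x: "x \<in> X"
  shows "metric_basis k X d (insert x S)"
proof -
  have gen: "metric_generator k X d S" and least: "\<And>T. metric_generator k X d T \<Longrightarrow> S \<lesssim> T"
    using S by (auto simp: metric_basis_def)
  have "infinite {z \<in> insert x S. distinguishes d z a b} \<or>
      k \<le> card {z \<in> insert x S. distinguishes d z a b}"
    if "a \<in> X" "b \<in> X" "a \<noteq> b" for a b
  proof -
    have sub: "{z \<in> S. distinguishes d z a b} \<subseteq> {z \<in> insert x S. distinguishes d z a b}"
      by blast
    have "infinite {z \<in> S. distinguishes d z a b} \<or> k \<le> card {z \<in> S. distinguishes d z a b}"
      using gen that by (auto simp: metric_generator_def)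
    then show ?thesis
      using finite_subset[OF sub] card_mono[OF _ sub] le_trans by blast
  qed
  then have "metric_generator k X d (insert x S)"
    using gen x by (simp add: metric_generator_def)
  moreover have "insert x S \<lesssim> S"
    using infinite_insert_eqpoll[OF inf] by (rule eqpoll_imp_lepoll)
  ultimately show ?thesis
    using least lepoll_trans unfolding metric_basis_def by blast
qed

section \<open>Partnered, pseudopartnered and unpartnered points\<close>

definition partners :: "'a set \<Rightarrow> ('a \<Rightarrow> 'a \<Rightarrow> real) \<Rightarrow> 'a \<Rightarrow> 'a \<Rightarrow> bool" where
  "partners X d x y \<longleftrightarrow> x \<in> X \<and> y \<in> X \<and> x \<noteq> y \<and>
     (\<forall>z \<in> X - {x, y}. d x z \<ge> d x y \<and> d y z \<ge> d x y)"

definition partnered :: "'a set \<Rightarrow> ('a \<Rightarrow> 'a \<Rightarrow> real) \<Rightarrow> 'a \<Rightarrow> bool" where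
  "partnered X d x \<longleftrightarrow> (\<exists>y\<in>X. partners X d x y)"

definition pseudopartnered :: "'a set \<Rightarrow> ('a \<Rightarrow> 'a \<Rightarrow> real) \<Rightarrow> 'a \<Rightarrow> bool" where
  "pseudopartnered X d x \<longleftrightarrow> x \<in> X \<and> \<not> partnered X d x \<and>
     (\<exists>y\<in>X. y \<noteq> x \<and> (\<forall>z \<in> X - {x, y}. d x z \<ge> d x y))"

definition unpartnered :: "'a set \<Rightarrow> ('a \<Rightarrow> 'a \<Rightarrow> real) \<Rightarrow> 'a \<Rightarrow> bool" where
  "unpartnered X d x \<longleftrightarrow> x \<in> X \<and> \<not> partnered X d x \<and> \<not> pseudopartnered X d x"

definition partnered_points :: "'a set \<Rightarrow> ('a \<Rightarrow> 'a \<Rightarrow> real) \<Rightarrow> 'a set" where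
  "partnered_points X d = {x \<in> X. partnered X d x}"

section \<open>Pseudopartnering sequences and pseudo-completeness\<close>

definition eball :: "'a set \<Rightarrow> ('a \<Rightarrow> 'a \<Rightarrow> real) \<Rightarrow> 'a \<Rightarrow> ereal \<Rightarrow> 'a set" where
  "eball X d x r = {p \<in> X. ereal (d x p) < r}"

definition ball_distances :: "'a set \<Rightarrow> ('a \<Rightarrow> 'a \<Rightarrow> real) \<Rightarrow> 'a \<Rightarrow> ereal \<Rightarrow> real set" where
  "ball_distances X d x r = {d x z | z. z \<in> eball X d x r - {x}}"

definition has_minimum :: "real set \<Rightarrow> bool" where
  "has_minimum I \<longleftrightarrow> (\<exists>m\<in>I. \<forall>i\<in>I. m \<le> i)"

text \<open>One step from \<open>(x\<^sub>n, d\<^sub>n) = (x, r)\<close> to \<open>(x\<^sub>n\<^sub>+\<^sub>1, d\<^sub>n\<^sub>+\<^sub>1) = (x', r')\<close>. When \<open>r > 0\<close> the ball contains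
  \<open>x\<close>, so the first \<open>else\<close> is the case of a ball with more than one point, possibly infinitely
  many (where \<open>card\<close> is 0).\<close>
definition pseudopartnering_step ::
    "'a set \<Rightarrow> ('a \<Rightarrow> 'a \<Rightarrow> real) \<Rightarrow> 'a \<Rightarrow> ereal \<Rightarrow> 'a \<Rightarrow> ereal \<Rightarrow> bool" where
  "pseudopartnering_step X d x r x' r' \<longleftrightarrow>
     (if card (eball X d x r) = 1 \<or> r = 0 then x' = x \<and> r' = 0
      else if \<not> has_minimum (ball_distances X d x r) then x' = x \<and> r' = 0
      else x' \<in> {z \<in> X. d x z = (LEAST m. m \<in> ball_distances X d x r)} \<and> r' = ereal (d x x'))"

text \<open>Sequences are indexed from 1; their values at 0 are irrelevant.\<close>
definition pseudopartnering_sequence ::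
    "'a set \<Rightarrow> ('a \<Rightarrow> 'a \<Rightarrow> real) \<Rightarrow> 'a \<Rightarrow> (nat \<Rightarrow> 'a) \<Rightarrow> (nat \<Rightarrow> ereal) \<Rightarrow> bool" where
  "pseudopartnering_sequence X d x xs ds \<longleftrightarrow> xs 1 = x \<and> ds 1 = \<infinity> \<and>
     (\<forall>n\<ge>1. pseudopartnering_step X d (xs n) (ds n) (xs (n + 1)) (ds (n + 1)))"

definition pseudolimit :: "'a set \<Rightarrow> ('a \<Rightarrow> 'a \<Rightarrow> real) \<Rightarrow> (nat \<Rightarrow> 'a) \<Rightarrow> 'a \<Rightarrow> bool" where
  "pseudolimit X d xs z \<longleftrightarrow> z \<in> X \<and> (\<forall>n\<ge>1. d z (xs n) = d (xs n) (xs (n + 1)))"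

definition pseudo_complete :: "'a set \<Rightarrow> ('a \<Rightarrow> 'a \<Rightarrow> real) \<Rightarrow> bool" where
  "pseudo_complete X d \<longleftrightarrow> (\<forall>x\<in>X. pseudopartnered X d x \<longrightarrow>
     (\<forall>xs ds. pseudopartnering_sequence X d x xs ds \<longrightarrow> (\<exists>z. pseudolimit X d xs z)) \<and>
     (\<exists>xs ds. pseudopartnering_sequence X d x xs ds \<and> finite {z. pseudolimit X d xs z}))"

end

theory Submission
  imports Defs
begin

text \<open>
  In an ultrametric space two partners \<open>x\<close>, \<open>y\<close> have the same distance to every third point, so
  only \<open>x\<close> and \<open>y\<close> distinguish them, and every 2-metric generator contains both
  (\<open>partnered_points_subset_generator\<close>). Hence the partnered points lie in every 2-metric generator,
  and everything follows once they are shown to form a 2-metric generator themselves.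

  Let \<open>x \<noteq> y\<close> and \<open>r = d x y\<close>. All points of the open balls \<open>B\<^sub>r(x)\<close> and \<open>B\<^sub>r(y)\<close> distinguish
  \<open>x\<close> from \<open>y\<close>. If both balls are singletons, then \<open>x\<close> and \<open>y\<close> are partners. It remains to see that
  a ball with more than one point contains a pair of partners (\<open>ball_contains_partners\<close>).

  Suppose that \<open>B\<^sub>r(x)\<close> has more than one point but none that is partnered. Since no point is
  unpartnered, every point has a nearest neighbour. Along a pseudopartnering sequence from \<open>x\<close> each
  term is a nearest neighbour of its predecessor, and the sequence cannot stop: if no point is nearer
  to \<open>x\<^sub>n\<^sub>+\<^sub>1\<close> than \<open>x\<^sub>n\<close> is, then the two are partners. So the distances \<open>d(x\<^sub>n, x\<^sub>n\<^sub>+\<^sub>1)\<close> decrease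
  strictly. The set \<open>L\<close> of pseudolimits is the intersection of the open balls around \<open>x\<^sub>n\<^sub>+\<^sub>1\<close> with
  radius \<open>d(x\<^sub>n, x\<^sub>n\<^sub>+\<^sub>1)\<close>; by pseudo-completeness it is nonempty, and finite for a suitable sequence.
  A point outside \<open>L\<close> is farther from a \<open>u \<in> L\<close> than some \<open>x\<^sub>n\<close>, so the nearest neighbours of \<open>u\<close>
  lie in \<open>L\<close>. Thus \<open>L\<close> has at least two points, and a closest pair in the finite set \<open>L\<close> is a pair
  of partners within \<open>B\<^sub>r(x)\<close> (\<open>finite_pseudolimits_imp_partners\<close>).
\<close>

section \<open>Balls and partners in ultrametric spaces\<close>

context Ultrametric_space
begin

lemma isosceles:
  assumes "x \<in> M" "y \<in> M" "z \<in> M" "d x y < d y z"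
  shows "d x z = d y z"
  using ultra[of x z y] ultra[of y z x] assms commute[of x y] by auto

lemma partners_sym: "partners M d x y \<Longrightarrow> partners M d y x"
  by (auto simp: partners_def commute insert_commute)

lemma partners_imp_partnered:
  assumes "partners M d x y"
  shows "x \<in> partnered_points M d" "y \<in> partnered_points M d"
  using assms partners_sym[OF assms] by (auto simp: partnered_points_def partnered_def partners_def)

lemma partners_indistinguishable:
  assumes "partners M d x y" "z \<in> M" "z \<noteq> x" "z \<noteq> y"
  shows "d x z = d y z"
  using assms ultra[of x z y] ultra[of y z x] commute[of x y] by (auto simp: partners_def)

lemma partnered_points_subset_generator:
  assumes S: "metric_generator 2 M d S"
  shows "partnered_points M d \<subseteq> S"
proof
  fix x assume "x \<in> partnered_points M d"
  then obtain y where xy: "partners M d x y"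
    by (auto simp: partnered_points_def partnered_def)
  then have mem: "x \<in> M" "y \<in> M" "x \<noteq> y" by (auto simp: partners_def)
  let ?D = "{z \<in> S. distinguishes d z x y}"
  have sub: "?D \<subseteq> {x, y}"
    using S partners_indistinguishable[OF xy]
    by (auto simp: metric_generator_def distinguishes_def)
  then have "finite ?D" by (rule finite_subset) simp
  then have "2 \<le> card ?D"
    using S mem by (auto simp: metric_generator_def)
  then have "?D = {x, y}"
    using sub mem by (intro card_seteq) auto
  then show "x \<in> S" by blast
qed

definition nearest :: "'a \<Rightarrow> 'a \<Rightarrow> bool" where
  "nearest x y \<longleftrightarrow> y \<in> M \<and> y \<noteq> x \<and> (\<forall>z\<in>M - {x}. d x y \<le> d x z)"

lemma not_unpartnered_imp_nearest:
  assumes "x \<in> M" "\<not> unpartnered M d x"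
  obtains y where "nearest x y"
proof -
  have "\<exists>y\<in>M. y \<noteq> x \<and> (\<forall>z\<in>M - {x, y}. d x y \<le> d x z)"
    using assms
    by (fastforce simp: unpartnered_def pseudopartnered_def partnered_def partners_def)
  then show ?thesis
    using that by (force simp: nearest_def)
qed

section \<open>Pseudopartnering sequences\<close>

text \<open>Of the three alternatives in a step, the two that end the sequence are ruled out by a second
  point of the ball and by a nearest neighbour of its centre.\<close>
lemma pseudopartnering_step_nearest:
  assumes step: "pseudopartnering_step M d a r b s" and a: "a \<in> M" and r: "0 < r"
    and c: "c \<in> M" "c \<noteq> a" "ereal (d a c) < r" and y: "nearest a y"
  shows "nearest a b" "s = ereal (d a b)" "ereal (d a b) < r"
proof -
  have "{a, c} \<subseteq> eball M d a r"
    using a c r by (auto simp: eball_def zero_ereal_def)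
  then have card: "card (eball M d a r) \<noteq> 1"
    using c by (auto simp: card_1_singleton_iff)
  have "d a y \<le> d a c"
    using c y by (auto simp: nearest_def)
  then have yr: "ereal (d a y) < r"
    using c(3) by (meson ereal_less_eq(3) le_less_trans)
  have mem: "d a y \<in> ball_distances M d a r"
    using y yr by (auto simp: ball_distances_def eball_def nearest_def)
  have min: "d a y \<le> m" if "m \<in> ball_distances M d a r" for m
    using that y by (auto simp: ball_distances_def eball_def nearest_def)
  have "has_minimum (ball_distances M d a r)"
    using mem min by (auto simp: has_minimum_def)
  moreover have "(LEAST m. m \<in> ball_distances M d a r) = d a y"
    using mem min by (rule Least_equality)
  ultimately have b: "b \<in> M" "d a b = d a y" "s = ereal (d a b)"
    using step card r by (auto simp: pseudopartnering_step_def split: if_splits)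
  show "s = ereal (d a b)" by (rule b)
  show "ereal (d a b) < r" using b yr by simp
  have "0 < d a y" using y a by (auto simp: nearest_def)
  then have "b \<noteq> a" using b a by auto
  then show "nearest a b" using b y by (auto simp: nearest_def)
qed

lemma pseudopartnering_sequence_nearest:
  assumes seq: "pseudopartnering_sequence M d x xs ds"
    and nounp: "\<forall>a\<in>M. \<not> unpartnered M d a"
    and x: "x \<in> M" and p: "p \<in> M" "p \<noteq> x" "d x p < r"
    and nop: "\<forall>u\<in>partnered_points M d. \<not> d x u < r"
    and n: "1 \<le> n"
  shows "xs n \<in> M \<and> d x (xs n) < r \<and> nearest (xs n) (xs (n + 1)) \<and>
    ds (n + 1) = ereal (d (xs n) (xs (n + 1))) \<and>
    ereal (d (xs n) (xs (n + 1))) < ds n \<and> d (xs n) (xs (n + 1)) < r"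
  using n
proof (induction n rule: dec_induct)
  case base
  have start: "xs 1 = x" "ds 1 = \<infinity>" "pseudopartnering_step M d x \<infinity> (xs (1 + 1)) (ds (1 + 1))"
    using seq unfolding pseudopartnering_sequence_def by (auto dest: spec[of _ 1])
  obtain y where y: "nearest x y"
    using nounp x not_unpartnered_imp_nearest by blast
  note facts = pseudopartnering_step_nearest[OF start(3) x _ p(1,2) _ y]
  have "nearest x (xs (1 + 1))" by (rule facts) auto
  moreover have "ds (1 + 1) = ereal (d x (xs (1 + 1)))" by (rule facts) auto
  moreover have "d x (xs (1 + 1)) < r"
    using \<open>nearest x (xs (1 + 1))\<close> p by (force simp: nearest_def)
  moreover have "d x x < r"
    using x p(3) nonneg[of x p] by (simp del: nonneg)
  ultimately show ?case using start x by simp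
next
  case (step n)
  let ?a = "xs n" and ?b = "xs (n + 1)"
  have a: "?a \<in> M" "d x ?a < r" and near: "nearest ?a ?b" and ds: "ds (n + 1) = ereal (d ?a ?b)"
    and ab: "d ?a ?b < r"
    using step.IH by auto
  have b: "?b \<in> M" "?b \<noteq> ?a" using near by (auto simp: nearest_def)
  have pos: "0 < d ?a ?b" using a b by auto
  have st: "pseudopartnering_step M d ?b (ds (n + 1)) (xs (n + 1 + 1)) (ds (n + 1 + 1))"
    using seq by (simp add: pseudopartnering_sequence_def)
  have "d x ?b < r"
    using ultra[of x ?b ?a] x a b ab by auto
  \<comment> \<open>Otherwise \<open>x\<^sub>n\<close> and \<open>x\<^sub>n\<^sub>+\<^sub>1\<close> would be partners, and \<open>x\<^sub>n\<close> lies in the ball.\<close>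
  have "\<exists>c\<in>M. c \<noteq> ?b \<and> d ?b c < d ?a ?b"
  proof (rule ccontr)
    assume "\<not> ?thesis"
    then have "partners M d ?a ?b"
      using a b near by (auto simp: partners_def nearest_def not_less)
    then show False using nop a partners_imp_partnered by blast
  qed
  then obtain c where c: "c \<in> M" "c \<noteq> ?b" "ereal (d ?b c) < ds (n + 1)"
    using ds by auto
  obtain y where y: "nearest ?b y"
    using nounp b not_unpartnered_imp_nearest by blast
  have "0 < ds (n + 1)" using ds pos by (simp add: zero_ereal_def)
  from pseudopartnering_step_nearest[OF st b(1) this c y] \<open>d x ?b < r\<close> b(1) ds ab
  show ?case by auto
qed

section \<open>Pseudolimits and partners\<close>

text \<open>Two pseudolimits are closer to each other than to any \<open>x\<^sub>n\<close>, and a point that is closer to a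
  pseudolimit than every \<open>x\<^sub>n\<close> is itself a pseudolimit: the pseudolimits are the intersection of
  a decreasing sequence of balls.\<close>
lemma finite_pseudolimits_imp_partners:
  assumes xs: "\<And>n. 1 \<le> n \<Longrightarrow> xs n \<in> M"
    and dec: "\<And>n. 1 \<le> n \<Longrightarrow> d (xs (n + 1)) (xs (n + 1 + 1)) < d (xs n) (xs (n + 1))"
    and nounp: "\<forall>a\<in>M. \<not> unpartnered M d a"
    and fin: "finite {z. pseudolimit M d xs z}" and w: "pseudolimit M d xs w"
  obtains u v where "pseudolimit M d xs u" "partners M d u v"
proof -
  define L where "L = {z. pseudolimit M d xs z}"
  define e where "e n = d (xs n) (xs (n + 1))" for n
  have L: "z \<in> L \<longleftrightarrow> z \<in> M \<and> (\<forall>n\<ge>1. d z (xs n) = e n)" for z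
    by (auto simp: L_def e_def pseudolimit_def)
  have e_dec: "e (n + 1) < e n" if "1 \<le> n" for n
    using dec[OF that] by (simp add: e_def)
  have close: "d u v < e n" if "u \<in> L" "v \<in> L" "1 \<le> n" for u v n
  proof -
    have "d u v \<le> max (d u (xs (n + 1))) (d (xs (n + 1)) v)"
      using that L xs by (intro ultra) auto
    also have "\<dots> = e (n + 1)"
      using that L commute by auto
    finally show ?thesis using e_dec[OF that(3)] by simp
  qed
  have far: "\<exists>n\<ge>1. e n \<le> d u q" if "u \<in> L" "q \<in> M" "q \<notin> L" for u q
  proof (rule ccontr)
    assume "\<not> ?thesis"
    then have "d u q < e n" if "1 \<le> n" for n
      using that by (meson not_le)
    then have "d q u < d u (xs n)" if "1 \<le> n" for n
      using that \<open>u \<in> L\<close> L[of u] commute[of q u] by simp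
    then have "d q (xs n) = d u (xs n)" if "1 \<le> n" for n
      using that \<open>u \<in> L\<close> \<open>q \<in> M\<close> L xs by (intro isosceles) auto
    then have "q \<in> L" using \<open>u \<in> L\<close> \<open>q \<in> M\<close> by (auto simp: L)
    then show False using \<open>q \<notin> L\<close> by blast
  qed
  have wL: "w \<in> L" "w \<in> M" using w by (auto simp: L_def pseudolimit_def)
  obtain y where y: "nearest w y"
    using nounp wL not_unpartnered_imp_nearest by blast
  have "y \<in> L"
  proof (rule ccontr)
    assume "y \<notin> L"
    then obtain n where n: "1 \<le> n" "e n \<le> d w y"
      using far[OF wL(1), of y] y by (auto simp: nearest_def)
    have "d w (xs (n + 1)) < d w y"
      using wL n e_dec[OF n(1)] by (auto simp: L)
    moreover have "xs (n + 1) \<noteq> w"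
    proof
      assume eq: "xs (n + 1) = w"
      have "d w (xs (n + 1)) = e (n + 1)" using wL(1) L[of w] le_add2 by blast
      then have "e (n + 1) = d w w" using eq by simp
      then have "e (n + 1) = 0" using wL by simp
      moreover have "0 \<le> e (n + 1 + 1)" by (simp add: e_def)
      ultimately show False
        using e_dec[of "n + 1"] by simp
    qed
    ultimately show False
      using y xs[of "n + 1"] by (force simp: nearest_def)
  qed
  define Q where "Q = {q \<in> L \<times> L. fst q \<noteq> snd q}"
  have "finite Q" using fin by (simp add: Q_def L_def)
  moreover have "(w, y) \<in> Q" using wL \<open>y \<in> L\<close> y by (auto simp: Q_def nearest_def)
  ultimately obtain q where q: "q \<in> Q" "\<And>q'. q' \<in> Q \<Longrightarrow> d (fst q) (snd q) \<le> d (fst q') (snd q')"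
    using ex_min_if_finite[of "(\<lambda>q. d (fst q) (snd q)) ` Q"] by (force simp: not_less)
  obtain u v where uv: "q = (u, v)" by (cases q)
  have uvL: "u \<in> L" "v \<in> L" "u \<noteq> v" using q uv by (auto simp: Q_def)
  have ge: "d u v \<le> d a z" if "a \<in> L" "z \<in> M" "z \<noteq> a" for a z
  proof (cases "z \<in> L")
    case True
    then show ?thesis using q(2)[of "(a, z)"] that uv by (auto simp: Q_def)
  next
    case False
    then obtain n where "1 \<le> n" "e n \<le> d a z" using far \<open>a \<in> L\<close> \<open>z \<in> M\<close> by blast
    then show ?thesis using close[OF uvL(1,2)] by force
  qed
  have "partners M d u v"
    using uvL ge by (auto simp: partners_def L)
  then show ?thesis using that uvL by (auto simp: L_def)
qed

text \<open>It suffices to find one partnered point: the partner of a point in a ball with more than one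
  point is among its nearest neighbours and therefore in the same ball.\<close>
lemma ball_contains_partners:
  assumes pc: "pseudo_complete M d" and nounp: "\<forall>a\<in>M. \<not> unpartnered M d a"
    and x: "x \<in> M" and p: "p \<in> M" "p \<noteq> x" "d x p < r"
  obtains u v where "partners M d u v" "d x u < r" "d x v < r"
proof -
  have "\<exists>u\<in>partnered_points M d. d x u < r"
  proof (rule ccontr)
    assume "\<not> ?thesis"
    then have nop: "\<forall>u\<in>partnered_points M d. \<not> d x u < r"
      by blast
    have "0 < r" using nonneg[of x p] p by linarith
    then have "pseudopartnered M d x"
      using nop nounp x by (auto simp: unpartnered_def partnered_points_def)
    then obtain xs ds where seq: "pseudopartnering_sequence M d x xs ds"
      and fin: "finite {z. pseudolimit M d xs z}"
      using pc x unfolding pseudo_complete_def by meson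
    obtain w where w: "pseudolimit M d xs w"
      using pc x seq \<open>pseudopartnered M d x\<close> unfolding pseudo_complete_def by meson
    note terms = pseudopartnering_sequence_nearest[OF seq nounp x p nop]
    have dec: "d (xs (n + 1)) (xs (n + 1 + 1)) < d (xs n) (xs (n + 1))" if "1 \<le> n" for n
      using terms[OF that] terms[of "n + 1"] by simp
    obtain u v where u: "pseudolimit M d xs u" and uv: "partners M d u v"
      using finite_pseudolimits_imp_partners[OF _ dec nounp fin w] terms by blast
    have "xs 1 = x" using seq by (simp add: pseudopartnering_sequence_def)
    then have "d x u < r"
      using u terms[of 1] commute[of u x] by (auto simp: pseudolimit_def)
    then show False using nop partners_imp_partnered(1)[OF uv] by blast
  qed
  then obtain u v where uv: "partners M d u v" and u: "d x u < r"
    by (auto simp: partnered_points_def partnered_def)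
  then have mem: "u \<in> M" "v \<in> M" by (auto simp: partners_def)
  have le: "d u v \<le> d u z" if "z \<in> M" "z \<noteq> u" for z
    using uv that by (cases "z = v") (auto simp: partners_def)
  have "d u v < r"
  proof (cases "u = x")
    case True
    then show ?thesis using le[of p] p by auto
  next
    case False
    then show ?thesis using le[of x] x u commute[of u x] by auto
  qed
  then have "d x v < r"
    using ultra[of x v u] x mem u by auto
  then show ?thesis using that uv u by blast
qed

lemma two_distinguishing:
  assumes "u \<in> S" "v \<in> S" "u \<noteq> v" "distinguishes d u x y" "distinguishes d v x y"
  shows "infinite {z \<in> S. distinguishes d z x y} \<or> 2 \<le> card {z \<in> S. distinguishes d z x y}"
  using card_mono[of "{z \<in> S. distinguishes d z x y}" "{u, v}"] assms by auto

lemma ball_distinguishes: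
  assumes "x \<in> M" "y \<in> M" "u \<in> M" "d x u < d x y"
  shows "distinguishes d u x y" "distinguishes d u y x"
  using isosceles[of u x y] assms by (auto simp: distinguishes_def commute)

lemma metric_generator_partnered_points:
  assumes pc: "pseudo_complete M d" and nounp: "\<forall>a\<in>M. \<not> unpartnered M d a"
  shows "metric_generator 2 M d (partnered_points M d)"
proof -
  have "infinite {z \<in> partnered_points M d. distinguishes d z x y} \<or>
      2 \<le> card {z \<in> partnered_points M d. distinguishes d z x y}"
    if x: "x \<in> M" and y: "y \<in> M" and ne: "x \<noteq> y" for x y
  proof -
    have "\<exists>u v. partners M d u v \<and> distinguishes d u x y \<and> distinguishes d v x y"
    proof (cases "partners M d x y")
      case True
      moreover have "distinguishes d x x y" "distinguishes d y x y"
        using x y ne by (auto simp: distinguishes_def)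
      ultimately show ?thesis by blast
    next
      case False
      then consider p where "p \<in> M" "p \<noteq> x" "d x p < d x y"
        | p where "p \<in> M" "p \<noteq> y" "d y p < d y x"
        using x y ne by (auto simp: partners_def not_le commute[of y x])
      then show ?thesis
      proof cases
        case 1
        then obtain u v where "partners M d u v" "d x u < d x y" "d x v < d x y"
          using ball_contains_partners[OF pc nounp x] by metis
        then show ?thesis
          using ball_distinguishes(1) x y unfolding partners_def by blast
      next
        case 2
        then obtain u v where "partners M d u v" "d y u < d y x" "d y v < d y x"
          using ball_contains_partners[OF pc nounp y] by metis
        then show ?thesis
          using ball_distinguishes(2) x y unfolding partners_def by blast
      qed
    qed
    then obtain u v where uv: "partners M d u v"
      and "distinguishes d u x y" "distinguishes d v x y" by blast
    moreover have "u \<noteq> v" using uv by (simp add: partners_def)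
    ultimately show ?thesis
      using partners_imp_partnered[OF uv] by (intro two_distinguishing)
  qed
  then show ?thesis
    by (auto simp: metric_generator_def partnered_points_def)
qed

end

section \<open>The partnered points as the 2-metric basis\<close>

theorem theorem2p30:
  fixes X :: "'a set" and d :: "'a \<Rightarrow> 'a \<Rightarrow> real"
  assumes "Ultrametric_space X d"
    and "pseudo_complete X d"
    and "\<exists>x\<in>X. \<exists>y\<in>X. x \<noteq> y"
    and "\<forall>x\<in>X. \<not> unpartnered X d x"
  shows "metric_basis 2 X d (partnered_points X d) \<and>
    (finite (partnered_points X d) \<or> partnered_points X d = X \<longrightarrow>
      (\<forall>S. metric_basis 2 X d S \<longrightarrow> S = partnered_points X d)) \<and>
    (\<forall>S. metric_generator 2 X d S \<longrightarrow> partnered_points X d \<subseteq> S)"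
proof -
  interpret Ultrametric_space X d by (rule assms(1))
  let ?P = "partnered_points X d"
  have gen: "metric_generator 2 X d ?P"
    using assms by (intro metric_generator_partnered_points)
  have sub: "?P \<subseteq> S" if "metric_generator 2 X d S" for S
    using that by (rule partnered_points_subset_generator)
  have "metric_basis 2 X d ?P"
    using gen sub by (auto simp: metric_basis_def intro: subset_imp_lepoll)
  moreover have "S = ?P" if fin: "finite ?P \<or> ?P = X" and S: "metric_basis 2 X d S" for S
  proof -
    have gS: "metric_generator 2 X d S" and le: "S \<lesssim> ?P"
      using S gen by (auto simp: metric_basis_def)
    have "S \<subseteq> X" using gS by (simp add: metric_generator_def)
    show ?thesis
      using fin
    proof
      assume "finite ?P"
      moreover from this have "finite S"
        using le by (auto simp: lepoll_def intro: inj_on_finite)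
      ultimately have "card S \<le> card ?P"
        using le by (simp add: lepoll_iff_card_le)
      with \<open>finite S\<close> show ?thesis using card_seteq[OF _ sub[OF gS]] by simp
    next
      assume "?P = X"
      then show ?thesis using sub[OF gS] \<open>S \<subseteq> X\<close> by blast
    qed
  qed
  ultimately show ?thesis using sub by blast
qed

end
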